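(* (i) Let $\mathbb{F} \in \{\mathbb{R}, \mathbb{C}\}$, $k \in \mathbb{N}$, and let $\mathbb{A}$ be an arbitrary finite-dimensional $\mathbb{F}$-algebra endowed with any vector space topology. Then, given $A_1, \ldots, A_k \in \mathbb{A}$, there exist open sets $\mathcal{U}_i \subseteq \mathbb{A}$ with $A_i \in \mathcal{U}_i$ ($1 \leq i \leq k$) such that $$\dim \mathrm{Alg}_{\mathbb{F}}(\{X_1, \ldots, X_k\}) \geq \dim \mathrm{Alg}_{\mathbb{F}}(\{A_1, \ldots, A_k\})$$ whenever $X_i \in \mathcal{U}_i$ for all $1 \leq i \leq k$. In particular, if $\mathrm{Alg}_{\mathbb{F}}(\{A_1, \ldots, A_k\}) = \mathbb{A}$, then $\mathrm{Alg}_{\mathbb{F}}(\{X_1, \ldots, X_k\}) = \mathbb{A}$ whenever $X_i \in \mathcal{U}_i$ for all $1 \leq i \leq k$. (ii) Let $\mathbb{F} \in \{\mathbb{R}, \mathbb{C}\}$, $k \in \mathbb{N}$, let $\mathbb{A}$ be an arbitrary finite-dimensional $\mathbb{F}$-algebra, and let $\|\cdot\|$ be any vector space norm on $\mathbb{A}$. Suppose that $A_1, \ldots, A_k \in \mathbb{A}$ are such that $\mathrm{Alg}_{\mathbb{F}}(\{A_1, \ldots, A_k\}) = \mathbb{A}$. Then there exists an $\varepsilon > 0$ such that $\mathrm{Alg}_{\mathbb{F}}(\{X_1, \ldots, X_k\}) = \mathbb{A}$ whenever $X_1,\dots,X_k\in\mathbb{A}$ satisfy $$\max_{1 \leq i \leq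 k} \|X_i - A_i\| < \varepsilon.$$
   Context: An $\mathbb{F}$-algebra is a vector space $\mathbb{A}$ over $\mathbb{F}$ together with a multiplication given by an $\mathbb{F}$-bilinear map $\mathbb{A}\times\mathbb{A}\to\mathbb{A}$; it is not assumed to be associative, commutative or unital. A vector space topology is a Hausdorff topology making addition and multiplication by scalars continuous. A vector space norm is a norm on the underlying vector space (not assumed submultiplicative). $\mathrm{Alg}_{\mathbb{F}}(S)$ denotes the $\mathbb{F}$-subalgebra of $\mathbb{A}$ generated by $S$, i.e. the smallest linear subspace containing $S$ and closed under multiplication. Dimensions are over $\mathbb{F}$. *)

theory Defs
  imports "HOL-Analysis.Analysis"
begin

text \<open>
  The scalar multiplication, the product, the topology and the norm are explicit parameters: the
  underlying type is only an abelian group, and no preferred topology or norm comes with it.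
  The product is an arbitrary bilinear map (not necessarily associative, commutative or unital).
\<close>

locale fin_dim_algebra = vector_space smul
  for smul :: "'f::field \<Rightarrow> 'a::ab_group_add \<Rightarrow> 'a" +
  fixes mul :: "'a \<Rightarrow> 'a \<Rightarrow> 'a"
  assumes linear_mul_right: "\<And>x. Vector_Spaces.linear smul smul (\<lambda>y. mul x y)"
    and linear_mul_left: "\<And>y. Vector_Spaces.linear smul smul (\<lambda>x. mul x y)"
    and finite_dimensional: "\<exists>B. finite B \<and> span B = UNIV"

definition is_subalgebra ::
  "('f::field \<Rightarrow> 'a::ab_group_add \<Rightarrow> 'a) \<Rightarrow> ('a \<Rightarrow> 'a \<Rightarrow> 'a) \<Rightarrow> 'a set \<Rightarrow> bool" where
  "is_subalgebra smul mul B \<longleftrightarrow>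
     module.subspace smul B \<and> (\<forall>x\<in>B. \<forall>y\<in>B. mul x y \<in> B)"

definition Alg ::
  "('f::field \<Rightarrow> 'a::ab_group_add \<Rightarrow> 'a) \<Rightarrow> ('a \<Rightarrow> 'a \<Rightarrow> 'a) \<Rightarrow> 'a set \<Rightarrow> 'a set" where
  "Alg smul mul S = is_subalgebra smul mul hull S"

definition vector_space_topology ::
  "('f::real_normed_field \<Rightarrow> 'a::ab_group_add \<Rightarrow> 'a) \<Rightarrow> 'a topology \<Rightarrow> bool" where
  "vector_space_topology smul T \<longleftrightarrow>
     topspace T = UNIV \<and> Hausdorff_space T \<and>
     continuous_map (prod_topology T T) T (\<lambda>(x, y). x + y) \<and>
     continuous_map (prod_topology euclidean T) T (\<lambda>(c, x). smul c x)"

definition vector_space_norm ::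
  "('f::real_normed_field \<Rightarrow> 'a::ab_group_add \<Rightarrow> 'a) \<Rightarrow> ('a \<Rightarrow> real) \<Rightarrow> bool" where
  "vector_space_norm smul nrm \<longleftrightarrow>
     (\<forall>x. nrm x \<ge> 0) \<and> (\<forall>x. nrm x = 0 \<longleftrightarrow> x = 0) \<and>
     (\<forall>x y. nrm (x + y) \<le> nrm x + nrm y) \<and>
     (\<forall>c x. nrm (smul c x) = norm c * nrm x)"

end

(* Every element of the subalgebra generated by the A i is the value at A of a continuous map f such
   that f X lies in the subalgebra generated by the X i for every X, because such values form a
   subalgebra containing the A i. Applied to a basis of that subalgebra, this yields, for X near A,
   equally many vectors generated by the X i that are close to a linearly independent family, hence
   linearly independent by diagonal dominance of their coordinates. Continuity of the product
   reduces to that of the coordinate functionals, which holds for every Hausdorff vector space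
   topology by compactness of the unit sphere of the maximum norm. *)
theory Submission
  imports Defs
begin

section \<open>Generated subalgebras and the expansion of the product in a basis\<close>

context fin_dim_algebra
begin

text \<open>The theory of dimension is stated relative to a fixed finite basis. Extending the empty
  independent set gives a basis, and a finite spanning set bounds the size of any independent
  set.\<close>

sublocale finite_dimensional_vector_space smul "extend_basis {}"
proof
  obtain B where "finite B" "span B = UNIV"
    using finite_dimensional by blast
  then show "finite (extend_basis {})"
    using independent_span_bound[of B "extend_basis {}"]
      independent_extend_basis[OF independent_empty] by auto
qed (simp_all add: independent_extend_basis independent_empty)

text \<open>A hull is an intersection, so it belongs to its class as soon as the class is closed
  under intersections.\<close>

lemma is_subalgebra_Alg: "is_subalgebra smul mul (Alg smul mul S)"
  unfolding Alg_def
proof (rule hull_in)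
  fix F assume F: "Ball F (is_subalgebra smul mul)"
  then have "subspace (\<Inter>F)"
    by (intro subspace_Inter) (auto simp: is_subalgebra_def)
  with F show "is_subalgebra smul mul (\<Inter>F)"
    by (auto simp: is_subalgebra_def)
qed

lemma subspace_Alg: "subspace (Alg smul mul S)"
  and mul_in_Alg: "x \<in> Alg smul mul S \<Longrightarrow> y \<in> Alg smul mul S \<Longrightarrow> mul x y \<in> Alg smul mul S"
  using is_subalgebra_Alg[of S] by (auto simp: is_subalgebra_def)

lemma generator_in_Alg: "x \<in> S \<Longrightarrow> x \<in> Alg smul mul S"
  by (simp add: Alg_def hull_inc)

lemma module_hom_representation:
  assumes "independent B" "span B = UNIV"
  shows "module_hom smul (*) (\<lambda>v. representation B v b)"
  using linear_representation[OF assms] by (rule Vector_Spaces.linear.axioms(3))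

text \<open>Bilinearity reduces the product to the fixed vectors \<open>mul b c\<close>; only the
  coordinates vary with \<open>x\<close> and \<open>y\<close>, so continuity of the product will
  follow from theirs.\<close>

lemma mul_eq_sum_representation:
  assumes B: "independent B" "span B = UNIV"
  shows "mul x y =
    (\<Sum>b\<in>B. \<Sum>c\<in>B. smul (representation B x b) (smul (representation B y c) (mul b c)))"
proof -
  have fin: "finite B"
    using B(1) by (rule finiteI_independent)
  note L = Vector_Spaces.linear.axioms(3)[OF linear_mul_left]
  note R = Vector_Spaces.linear.axioms(3)[OF linear_mul_right]
  have expand: "(\<Sum>b\<in>B. smul (representation B v b) b) = v" for v
    using B fin by (intro sum_representation_eq) auto
  have "mul (\<Sum>b\<in>B. smul (representation B x b) b) (\<Sum>c\<in>B. smul (representation B y c) c)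
      = (\<Sum>b\<in>B. \<Sum>c\<in>B. smul (representation B x b) (smul (representation B y c) (mul b c)))"
    by (simp only: module_hom.sum[OF L] module_hom.scale[OF L])
      (simp only: module_hom.sum[OF R] module_hom.scale[OF R] scale_sum_right)
  then show ?thesis
    by (simp only: expand)
qed

end

section \<open>Vector space topologies and continuity of coordinates\<close>

locale topological_fin_dim_algebra = fin_dim_algebra smul mul
  for smul :: "'f::{real_normed_field, heine_borel} \<Rightarrow> 'a::ab_group_add \<Rightarrow> 'a"
    and mul +
  fixes T :: "'a topology"
  assumes topology: "vector_space_topology smul T"
begin

lemma topspace [simp]: "topspace T = UNIV"
  and Hausdorff: "Hausdorff_space T"
  and continuous_map_add_pair: "continuous_map (prod_topology T T) T (\<lambda>(x, y). x + y)"
  and continuous_map_smul_pair: "continuous_map (prod_topology euclidean T) T (\<lambda>(c, x). smul c x)"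
  using topology by (auto simp: vector_space_topology_def)

lemma continuous_map_plus:
  assumes "continuous_map S T f" "continuous_map S T g"
  shows "continuous_map S T (\<lambda>x. f x + g x)"
  using continuous_map_compose[OF _ continuous_map_add_pair, of S "\<lambda>x. (f x, g x)"] assms
  by (simp add: continuous_map_paired o_def)

lemma continuous_map_smul:
  assumes "continuous_map S euclidean c" "continuous_map S T f"
  shows "continuous_map S T (\<lambda>x. smul (c x) (f x))"
  using continuous_map_compose[OF _ continuous_map_smul_pair, of S "\<lambda>x. (c x, f x)"] assms
  by (simp add: continuous_map_paired o_def)

lemma continuous_map_sum_vec:
  assumes "finite I" "\<And>i. i \<in> I \<Longrightarrow> continuous_map S T (f i)"
  shows "continuous_map S T (\<lambda>x. \<Sum>i\<in>I. f i x)"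
  using assms by (induction I) (auto intro: continuous_map_plus)

text \<open>
  A neighbourhood of 0 misses the compact set \<open>K\<close> of vectors whose largest coordinate is 1, so no
  small multiple of a vector near 0 lies in \<open>K\<close>, which bounds the coordinates of the vector.
\<close>
lemma representation_bounded_near_0:
  assumes B: "independent B" "span B = UNIV"
  obtains V r where "openin T V" "0 \<in> V" "r > 0"
    "\<And>v b. v \<in> V \<Longrightarrow> b \<in> B \<Longrightarrow> norm (representation B v b) \<le> r"
proof -
  have fin: "finite B"
    using B(1) by (rule finiteI_independent)
  interpret R: module_hom smul "(*)" "\<lambda>v. representation B v b" for b
    using B by (rule module_hom_representation)
  have expand: "(\<Sum>b\<in>B. smul (representation B v b) b) = v" for v
    using B fin by (intro sum_representation_eq) auto
  have repr: "representation B (\<Sum>b\<in>B. smul (c b) b) a = c a" if "a \<in> B" for c a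
    using that fin B by (simp add: R.sum R.scale representation_basis if_distrib cong: if_cong)
  define comb where "comb c = (\<Sum>b\<in>B. smul (c b) b)" for c
  define Box where "Box a = PiE B (\<lambda>b. if b = a then {1} else cball (0::'f) 1)" for a
  define K where "K = (\<Union>a\<in>B. comb ` Box a)"
  have cont: "continuous_map (product_topology (\<lambda>_. euclidean) B) T comb"
    unfolding comb_def
    by (intro continuous_map_sum_vec continuous_map_smul fin)
      (auto intro: continuous_map_product_projection)
  have "compactin T (comb ` Box a)" for a
  proof (rule image_compactin[OF _ cont])
    show "compactin (product_topology (\<lambda>_. euclidean) B) (Box a)"
      \<comment> \<open>Each factor is a singleton or a closed unit ball of scalars, compact because
        the field is \<open>heine_borel\<close>.\<close>
      unfolding Box_def compactin_PiE by auto
  qed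
  then have "compactin T K"
    unfolding K_def using fin by (intro compactin_Union) auto
  then have "closedin T K"
    using Hausdorff by (rule compactin_imp_closedin[rotated])
  then have openK: "openin T (- K)"
    by (simp add: closedin_def Compl_eq_Diff_UNIV)
  have "0 \<notin> K"
  proof
    assume "0 \<in> K"
    then obtain a c where a: "a \<in> B" and c: "c \<in> Box a" and 0: "0 = comb c"
      unfolding K_def by blast
    have "c a = 0"
      using repr[OF a, of c] 0 by (simp add: comb_def R.zero)
    moreover have "c a = 1"
      using c a by (force simp: Box_def PiE_iff)
    ultimately show False by simp
  qed
  \<comment> \<open>A product neighbourhood \<open>W \<times> V\<close> of \<open>(0, 0)\<close>
    inside \<open>P\<close> makes one \<open>V\<close> avoid \<open>K\<close> under all scalars from
    \<open>W\<close> at once.\<close>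
  define P where
    "P = {p \<in> topspace (prod_topology euclidean T). (case p of (c, x) \<Rightarrow> smul c x) \<in> - K}"
  have "openin (prod_topology euclidean T) P"
    unfolding P_def using continuous_map_smul_pair openK by (rule openin_continuous_map_preimage)
  moreover have "(0, 0) \<in> P"
    using \<open>0 \<notin> K\<close> by (simp add: P_def)
  ultimately obtain W V where W: "openin euclidean W" "0 \<in> W" and V: "openin T V" "0 \<in> V"
    and WV: "W \<times> V \<subseteq> P"
    unfolding openin_prod_topology_alt by blast
  from W obtain d where "d > 0" and d: "ball 0 d \<subseteq> W"
    by (auto simp: open_contains_ball)
  show thesis
  proof (rule that[OF V, of "1 / d"])
    show "1 / d > 0"
      using \<open>d > 0\<close> by simp
    fix v b assume v: "v \<in> V" and b: "b \<in> B"
    have "B \<noteq> {}"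
      using b by auto
    with fin have "Max ((\<lambda>b. norm (representation B v b)) ` B) \<in> (\<lambda>b. norm (representation B v b)) ` B"
      by (intro Max_in) auto
    then obtain a where a: "a \<in> B" and "norm (representation B v a) = Max ((\<lambda>b. norm (representation B v b)) ` B)"
      by auto
    then have max: "norm (representation B v c) \<le> norm (representation B v a)" if "c \<in> B" for c
      using that fin by simp
    show "norm (representation B v b) \<le> 1 / d"
    proof (rule ccontr)
      define m where "m = representation B v a"
      assume "\<not> ?thesis"
      then have large: "norm m > 1 / d"
        using max[OF b] by (simp add: m_def)
      then have pos: "norm m > 0"
        using \<open>d > 0\<close> by (meson less_trans zero_less_divide_1_iff)
      \<comment> \<open>These are the coordinates of \<open>v\<close> divided by the largest one. If
        \<open>norm m\<close> exceeded \<open>1 / d\<close>, then \<open>1 / m\<close> would lie in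
        \<open>W\<close> while \<open>smul (1 / m) v\<close> lies in \<open>K\<close>.\<close>
      define c where "c = (\<lambda>b\<in>B. representation B v b / m)"
      have "c \<in> Box a"
        using max pos a by (auto simp: c_def Box_def m_def norm_divide divide_simps)
      moreover have "comb c = smul (1 / m) v"
      proof -
        have "comb c = (\<Sum>b\<in>B. smul (1 / m) (smul (representation B v b) b))"
          unfolding comb_def c_def by (intro sum.cong) auto
        also have "\<dots> = smul (1 / m) v"
          unfolding scale_sum_right[symmetric] expand ..
        finally show ?thesis .
      qed
      ultimately have "smul (1 / m) v \<in> K"
        using a unfolding K_def by (metis UN_I imageI)
      moreover have "1 / m \<in> W"
        using d large pos \<open>d > 0\<close> by (intro subsetD[OF d]) (auto simp: norm_divide field_simps)
      with v WV have "smul (1 / m) v \<notin> K"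
        by (auto simp: P_def)
      ultimately show False by simp
    qed
  qed
qed

text \<open>A linear functional bounded on a neighbourhood of 0 is continuous: shrinking the
  neighbourhood shrinks the bound proportionally, and translation carries this to every
  point.\<close>

lemma continuous_map_representation:
  assumes B: "independent B" "span B = UNIV" and b: "b \<in> B"
  shows "continuous_map T euclidean (\<lambda>v. representation B v b)"
proof -
  interpret R: module_hom smul "(*)" "\<lambda>v. representation B v b"
    using B by (rule module_hom_representation)
  obtain V r where V: "openin T V" "0 \<in> V" and "r > 0"
    and bound: "\<And>v c. v \<in> V \<Longrightarrow> c \<in> B \<Longrightarrow> norm (representation B v c) \<le> r"
    by (rule representation_bounded_near_0[OF B]) blast
  have "continuous_map T Met_TC.mtopology (\<lambda>v. representation B v b)"
    unfolding Met_TC.continuous_map_to_metric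
  proof (intro ballI allI impI)
    fix x and e :: real assume "e > 0"
    \<comment> \<open>If \<open>s\<close> times \<open>y - x\<close> lies in \<open>V\<close>, the
      coordinates of \<open>y\<close> and \<open>x\<close> differ by at most \<open>e / 2\<close>;
      the factor 2 makes the final bound strict.\<close>
    define s where "s = (of_real (2 * r / e) :: 'f)"
    define g where "g y = smul s (y + - x)" for y
    define U where "U = {y \<in> topspace T. g y \<in> V}"
    have "continuous_map T T g"
      unfolding g_def by (intro continuous_map_smul continuous_map_plus) auto
    then have "openin T U"
      unfolding U_def using V(1) by (rule openin_continuous_map_preimage)
    moreover have "x \<in> U"
      by (simp add: U_def g_def V)
    moreover have "representation B y b \<in> Met_TC.mball (representation B x b) e" if "y \<in> U" for y
    proof -
      have "norm (representation B (g y) b) \<le> r"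
        using that b bound by (simp add: U_def)
      moreover have "norm (representation B (g y) b)
          = 2 * r / e * norm (representation B y b - representation B x b)"
        using \<open>r > 0\<close> \<open>e > 0\<close>
        by (simp add: g_def s_def R.scale R.diff norm_mult norm_divide)
      ultimately have "norm (representation B y b - representation B x b) \<le> e / 2"
        using \<open>r > 0\<close> \<open>e > 0\<close> by (simp add: field_simps)
      then show ?thesis
        using \<open>e > 0\<close> by (simp add: dist_norm norm_minus_commute)
    qed
    ultimately show "\<exists>U. openin T U \<and> x \<in> U \<and>
        (\<forall>y\<in>U. representation B y b \<in> Met_TC.mball (representation B x b) e)"
      by blast
  qed
  then show ?thesis
    by simp
qed

section \<open>Continuity of the product and continuous families of generated elements\<close>

lemma continuous_map_mul:
  assumes f: "continuous_map S T f" and g: "continuous_map S T g"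
  shows "continuous_map S T (\<lambda>x. mul (f x) (g x))"
proof -
  let ?B = "extend_basis {}"
  have B: "independent ?B" "span ?B = UNIV"
    by (simp_all add: independent_extend_basis independent_empty)
  have rep: "continuous_map S euclidean (\<lambda>x. representation ?B (h x) b)"
    if "continuous_map S T h" "b \<in> ?B" for h b
    using continuous_map_compose[OF that(1) continuous_map_representation[OF B that(2)]]
    by (simp add: o_def)
  have "continuous_map S T (\<lambda>x. \<Sum>b\<in>?B. \<Sum>c\<in>?B.
    smul (representation ?B (f x) b) (smul (representation ?B (g x) c) (mul b c)))"
    by (intro continuous_map_sum_vec finite_Basis continuous_map_smul rep f g) auto
  then show ?thesis
    by (simp only: mul_eq_sum_representation[OF B, symmetric])
qed

text \<open>The map \<open>f\<close> plays the role of a nonassociative polynomial without constant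
  term. \<open>restrict A I\<close> appears because the points of the product topology are
  extensional functions.\<close>

lemma Alg_element_continuous_family:
  assumes "a \<in> Alg smul mul (A ` I)"
  shows "\<exists>f. continuous_map (product_topology (\<lambda>_. T) I) T f \<and> f (restrict A I) = a \<and>
    (\<forall>X. f X \<in> Alg smul mul (X ` I))"
proof -
  define good where "good f \<longleftrightarrow> continuous_map (product_topology (\<lambda>_. T) I) T f \<and>
    (\<forall>X. f X \<in> Alg smul mul (X ` I))" for f
  \<comment> \<open>Minimality of the hull gives the claim once \<open>G\<close> is a subalgebra
    containing the generators, which are the values of the projections.\<close>
  define G where "G = {f (restrict A I) | f. good f}"
  have zero: "good (\<lambda>_. 0)"
    by (simp add: good_def subspace_0[OF subspace_Alg])
  have plus: "good (\<lambda>X. f X + g X)" if "good f" "good g" for f g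
    using that by (auto simp: good_def intro: continuous_map_plus subspace_add[OF subspace_Alg])
  have scale: "good (\<lambda>X. smul c (f X))" if "good f" for f c
    using that by (auto simp: good_def intro: continuous_map_smul subspace_scale[OF subspace_Alg])
  have times: "good (\<lambda>X. mul (f X) (g X))" if "good f" "good g" for f g
    using that by (auto simp: good_def intro: continuous_map_mul mul_in_Alg)
  have proj: "good (\<lambda>X. X i)" if "i \<in> I" for i
    using that by (auto simp: good_def intro: continuous_map_product_projection generator_in_Alg)
  have GI: "f (restrict A I) \<in> G" if "good f" for f
    using that by (auto simp: G_def)
  have GE: "\<exists>f. good f \<and> x = f (restrict A I)" if "x \<in> G" for x
    using that by (auto simp: G_def)
  have "is_subalgebra smul mul G"
    unfolding is_subalgebra_def
  proof (intro conjI ballI subspaceI)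
    show "0 \<in> G"
      using GI[OF zero] .
    show "smul c x \<in> G" if "x \<in> G" for c x
      using GE[OF that] GI[OF scale] by auto
    fix x y assume "x \<in> G" "y \<in> G"
    then obtain f g where fg: "good f" "good g" "x = f (restrict A I)" "y = g (restrict A I)"
      using GE by metis
    show "x + y \<in> G"
      using GI[OF plus[OF fg(1,2)]] fg by simp
    show "mul x y \<in> G"
      using GI[OF times[OF fg(1,2)]] fg by simp
  qed
  moreover have "A ` I \<subseteq> G"
  proof
    fix x assume "x \<in> A ` I"
    then obtain i where "i \<in> I" "x = A i" by blast
    then show "x \<in> G"
      using GI[OF proj, of i] by simp
  qed
  ultimately have "Alg smul mul (A ` I) \<subseteq> G"
    unfolding Alg_def by (simp add: hull_minimal)
  with assms show ?thesis
    unfolding G_def good_def by blast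
qed

section \<open>Stability of linear independence and semicontinuity of the dimension\<close>

text \<open>The \<open>B\<close>-coordinates of the vectors \<open>f b\<close> form the identity
  matrix plus entries smaller than \<open>1 / card B\<close>. In a linear relation, the coordinate
  belonging to a largest coefficient \<open>c a\<close> bounds \<open>norm (c a)\<close> by a
  multiple of itself with factor below 1, so all coefficients vanish.\<close>

lemma independent_perturbation:
  assumes D: "independent D" "span D = UNIV" and "B \<subseteq> D"
    and close: "\<And>b a. b \<in> B \<Longrightarrow> a \<in> B \<Longrightarrow> norm (representation D (f b - b) a) < 1 / card B"
  shows "inj_on f B" "independent (f ` B)"
proof -
  have fin: "finite B"
    using D(1) \<open>B \<subseteq> D\<close> finiteI_independent finite_subset by blast
  interpret R: module_hom smul "(*)" "\<lambda>v. representation D v b" for b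
    using D by (rule module_hom_representation)
  have zero: "c b = 0" if comb: "(\<Sum>b\<in>B. smul (c b) (f b)) = 0" and b: "b \<in> B" for c b
  proof -
    have "Max ((\<lambda>b. norm (c b)) ` B) \<in> (\<lambda>b. norm (c b)) ` B"
      using fin b by (intro Max_in) auto
    then obtain a where a: "a \<in> B" and "norm (c a) = Max ((\<lambda>b. norm (c b)) ` B)"
      by auto
    then have max: "norm (c b) \<le> norm (c a)" if "b \<in> B" for b
      using that fin by simp
    define \<delta> where "\<delta> b = representation D (f b - b) a" for b
    have basis: "representation D b a = (if b = a then 1 else 0)" if "b \<in> B" for b
      using that \<open>B \<subseteq> D\<close> D by (auto simp: representation_basis)
    have "0 = representation D (\<Sum>b\<in>B. smul (c b) (f b)) a"
      by (simp add: comb R.zero)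
    also have "\<dots> = (\<Sum>b\<in>B. c b * \<delta> b) + (\<Sum>b\<in>B. if b = a then c b else 0)"
      unfolding R.sum R.scale sum.distrib[symmetric]
      by (intro sum.cong) (auto simp: \<delta>_def R.diff basis algebra_simps)
    finally have "norm (c a) = norm (\<Sum>b\<in>B. c b * \<delta> b)"
      using fin a by (simp add: add_eq_0_iff2)
    also have "\<dots> \<le> (\<Sum>b\<in>B. norm (c a) * norm (\<delta> b))"
      by (rule sum_norm_le) (simp add: norm_mult max mult_right_mono)
    finally have le: "norm (c a) \<le> norm (c a) * (\<Sum>b\<in>B. norm (\<delta> b))"
      by (simp add: sum_distrib_left)
    have "(\<Sum>b\<in>B. norm (\<delta> b)) < (\<Sum>b\<in>B. 1 / card B)"
      using fin a close by (intro sum_strict_mono) (auto simp: \<delta>_def)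
    also have "\<dots> = 1"
      using fin a by auto
    finally have "norm (c a) \<le> 0"
      using le by (smt (verit) mult_less_cancel_left2)
    then show ?thesis
      using max[OF b] by simp
  qed
  show inj: "inj_on f B"
  proof (rule inj_onI, rule ccontr)
    fix x y assume xy: "x \<in> B" "y \<in> B" "f x = f y" "x \<noteq> y"
    \<comment> \<open>A collision \<open>f x = f y\<close> is itself a nontrivial relation, with
      coefficients 1 and -1.\<close>
    define c where "c b = (if b = x then 1 else if b = y then - 1 else 0 :: 'f)" for b
    have "(\<Sum>b\<in>B. smul (c b) (f b)) = (\<Sum>b\<in>{x, y}. smul (c b) (f b))"
      using fin xy by (intro sum.mono_neutral_right) (auto simp: c_def)
    also have "\<dots> = 0"
      using xy by (simp add: c_def)
    finally show False
      using zero[of c x] xy by (simp add: c_def)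
  qed
  show "independent (f ` B)"
  proof (rule independent_if_scalars_zero)
    fix c x assume "(\<Sum>x\<in>f ` B. smul (c x) x) = 0" "x \<in> f ` B"
    then show "c x = 0"
      using zero[of "c \<circ> f"] by (auto simp: sum.reindex[OF inj])
  qed (use fin in simp)
qed

text \<open>A basis \<open>B\<close> of the algebra generated by the \<open>A i\<close> is moved
  along continuous families. It is extended to a basis \<open>D\<close> of the whole space because
  the moved vectors may leave the span of \<open>B\<close>.\<close>

lemma dim_Alg_lower_semicontinuous:
  obtains U where "\<And>i. i \<in> I \<Longrightarrow> openin T (U i) \<and> A i \<in> U i"
    "\<And>X. (\<And>i. i \<in> I \<Longrightarrow> X i \<in> U i) \<Longrightarrow>
      dim (Alg smul mul (A ` I)) \<le> dim (Alg smul mul (X ` I))"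
proof -
  obtain B where B: "B \<subseteq> Alg smul mul (A ` I)" "independent B"
    "card B = dim (Alg smul mul (A ` I))"
    by (rule basis_exists)
  have fin: "finite B"
    using B(2) by (rule finiteI_independent)
  define D where "D = extend_basis B"
  have D: "independent D" "span D = UNIV" "B \<subseteq> D"
    using B(2) by (simp_all add: D_def independent_extend_basis extend_basis_superset)
  interpret R: module_hom smul "(*)" "\<lambda>v. representation D v b" for b
    using D(1,2) by (rule module_hom_representation)
  let ?P = "product_topology (\<lambda>_. T) I"
  have "\<forall>b\<in>B. \<exists>f. continuous_map ?P T f \<and> f (restrict A I) = b \<and>
    (\<forall>X. f X \<in> Alg smul mul (X ` I))"
    using Alg_element_continuous_family B(1) by blast
  then obtain f where f: "\<And>b. b \<in> B \<Longrightarrow> continuous_map ?P T (f b)"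
    "\<And>b. b \<in> B \<Longrightarrow> f b (restrict A I) = b"
    "\<And>b X. b \<in> B \<Longrightarrow> f b X \<in> Alg smul mul (X ` I)"
    by metis
  define S where "S b a = {Y \<in> topspace ?P.
    representation D (f b Y) a \<in> ball (representation D b a) (1 / card B)}" for b a
  \<comment> \<open>The intersection with the whole space matters when \<open>B\<close> is empty,
    since the indexed intersection is then \<open>UNIV\<close>, which may contain functions that are
    not extensional.\<close>
  define W where "W = (\<Inter>p\<in>B \<times> B. S (fst p) (snd p)) \<inter> topspace ?P"
  have "openin ?P (S b a)" if "b \<in> B" "a \<in> B" for b a
    unfolding S_def
  proof (rule openin_continuous_map_preimage)
    show "continuous_map ?P euclidean (\<lambda>Y. representation D (f b Y) a)"
      using continuous_map_compose[OF f(1) continuous_map_representation[OF D(1,2)], of b a]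
        that D(3) by (auto simp: o_def)
  qed simp
  then have "openin ?P W"
    unfolding W_def using fin by (intro openin_INT) auto
  moreover have "restrict A I \<in> W"
    using f(2) fin by (auto simp: W_def S_def card_gt_0_iff)
  ultimately have "\<exists>U. finite {i \<in> I. U i \<noteq> topspace T} \<and> (\<forall>i\<in>I. openin T (U i)) \<and>
      restrict A I \<in> Pi\<^sub>E I U \<and> Pi\<^sub>E I U \<subseteq> W"
    unfolding openin_product_topology_alt by (rule bspec)
  then obtain U where U: "\<And>i. i \<in> I \<Longrightarrow> openin T (U i)"
    "restrict A I \<in> Pi\<^sub>E I U" "Pi\<^sub>E I U \<subseteq> W"
    by blast
  show thesis
  proof (rule that)
    show "openin T (U i) \<and> A i \<in> U i" if "i \<in> I" for i
      using U(1,2) that by (auto simp: PiE_iff)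
    fix X assume X: "\<And>i. i \<in> I \<Longrightarrow> X i \<in> U i"
    \<comment> \<open>Only the restriction can be a point of the product space; it has the same
      image of \<open>I\<close>, hence generates the same subalgebra.\<close>
    let ?X = "restrict X I"
    have "?X \<in> W"
      using X U(3) by (intro subsetD[OF U(3)]) auto
    then have "norm (representation D (f b ?X - b) a) < 1 / card B" if "b \<in> B" "a \<in> B" for b a
      using that by (force simp: W_def S_def R.diff dist_norm norm_minus_commute)
    then have inj: "inj_on (\<lambda>b. f b ?X) B" and ind: "independent ((\<lambda>b. f b ?X) ` B)"
      using independent_perturbation[OF D, of "\<lambda>b. f b ?X"] by blast+
    have "(\<lambda>b. f b ?X) ` B \<subseteq> Alg smul mul (X ` I)"
      using f(3)[of _ ?X] by auto
    then have "card ((\<lambda>b. f b ?X) ` B) \<le> dim (Alg smul mul (X ` I))"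
      using ind by (rule independent_card_le_dim)
    then show "dim (Alg smul mul (A ` I)) \<le> dim (Alg smul mul (X ` I))"
      using B(3) by (simp add: card_image[OF inj])
  qed
qed

text \<open>The same neighbourhoods serve both claims: a subspace whose dimension reaches that of
  the whole space is the whole space.\<close>

lemma Alg_neighbourhoods:
  "\<exists>U. (\<forall>i\<in>I. openin T (U i) \<and> A i \<in> U i) \<and>
    (\<forall>X. (\<forall>i\<in>I. X i \<in> U i) \<longrightarrow> dim (Alg smul mul (X ` I)) \<ge> dim (Alg smul mul (A ` I))) \<and>
    (Alg smul mul (A ` I) = UNIV \<longrightarrow> (\<forall>X. (\<forall>i\<in>I. X i \<in> U i) \<longrightarrow> Alg smul mul (X ` I) = UNIV))"
proof -
  obtain U where U: "\<And>i. i \<in> I \<Longrightarrow> openin T (U i) \<and> A i \<in> U i"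
    "\<And>X. (\<And>i. i \<in> I \<Longrightarrow> X i \<in> U i) \<Longrightarrow>
      dim (Alg smul mul (A ` I)) \<le> dim (Alg smul mul (X ` I))"
    by (rule dim_Alg_lower_semicontinuous[of I A]) blast
  have "Alg smul mul (X ` I) = UNIV"
    if "Alg smul mul (A ` I) = UNIV" "\<forall>i\<in>I. X i \<in> U i" for X
    using U(2)[of X] that subspace_dim_equal[OF subspace_Alg subspace_UNIV, of "X ` I"]
    by auto
  with U show ?thesis
    by (intro exI[of _ U]) auto
qed

end

section \<open>Topologies induced by vector space norms\<close>

locale normed_vector_space = vector_space smul
  for smul :: "'f::real_normed_field \<Rightarrow> 'a::ab_group_add \<Rightarrow> 'a" +
  fixes nrm :: "'a \<Rightarrow> real"
  assumes vector_space_norm: "vector_space_norm smul nrm"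
begin

lemma nrm_nonneg: "nrm x \<ge> 0"
  and nrm_eq_0_iff: "nrm x = 0 \<longleftrightarrow> x = 0"
  and nrm_triangle: "nrm (x + y) \<le> nrm x + nrm y"
  and nrm_smul: "nrm (smul c x) = norm c * nrm x"
  using vector_space_norm by (auto simp: vector_space_norm_def)

lemma nrm_0 [simp]: "nrm 0 = 0"
  by (simp add: nrm_eq_0_iff)

lemma nrm_minus_commute: "nrm (x - y) = nrm (y - x)"
  using nrm_smul[of "- 1" "x - y"] by simp

text \<open>With the difference in this order, membership in a ball around \<open>A i\<close> reads
  \<open>nrm (X i - A i) < r\<close>.\<close>

sublocale Metric_space UNIV "\<lambda>x y. nrm (y - x)"
proof
  show "nrm (z - x) \<le> nrm (y - x) + nrm (z - y)" for x y z
    using nrm_triangle[of "y - x" "z - y"] by simp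
qed (auto simp: nrm_nonneg nrm_eq_0_iff nrm_minus_commute)

lemma vector_space_topology_mtopology: "vector_space_topology smul mtopology"
  unfolding vector_space_topology_def
proof (intro conjI)
  show "topspace mtopology = UNIV"
    by simp
  show "Hausdorff_space mtopology"
    by (rule Hausdorff_space_mtopology)
  show "continuous_map (prod_topology mtopology mtopology) mtopology (\<lambda>(x, y). x + y)"
    unfolding continuous_map_to_metric
  proof (intro ballI allI impI)
    fix p :: "'a \<times> 'a" and e :: real assume "e > 0"
    obtain x y where p: "p = (x, y)" by fastforce
    let ?U = "mball x (e / 2) \<times> mball y (e / 2)"
    have "openin (prod_topology mtopology mtopology) ?U" "p \<in> ?U"
      using \<open>e > 0\<close> by (auto simp: p openin_prod_Times_iff)
    moreover have "(case q of (x, y) \<Rightarrow> x + y) \<in> mball (case p of (x, y) \<Rightarrow> x + y) e"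
      if "q \<in> ?U" for q
    proof -
      obtain x' y' where q: "q = (x', y')" by fastforce
      have "nrm ((x' + y') - (x + y)) \<le> nrm (x' - x) + nrm (y' - y)"
        using nrm_triangle[of "x' - x" "y' - y"] by (simp add: algebra_simps)
      then show ?thesis
        using that by (auto simp: p q)
    qed
    ultimately show "\<exists>U. openin (prod_topology mtopology mtopology) U \<and> p \<in> U \<and>
      (\<forall>q\<in>U. (case q of (x, y) \<Rightarrow> x + y) \<in> mball (case p of (x, y) \<Rightarrow> x + y) e)"
      by blast
  qed
  show "continuous_map (prod_topology euclidean mtopology) mtopology (\<lambda>(c, x). smul c x)"
    unfolding continuous_map_to_metric
  proof (intro ballI allI impI)
    fix p :: "'f \<times> 'a" and e :: real assume "e > 0"
    obtain c x where p: "p = (c, x)" by fastforce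
    \<comment> \<open>Within distance \<open>d \<le> 1\<close> the norm of \<open>x'\<close> is at
      most \<open>nrm x + 1\<close>, so the two parts of \<open>c' x' - c x\<close> add up to less
      than \<open>d * s\<close>, which is at most \<open>e\<close>.\<close>
    define s where "s = nrm x + 1 + norm c"
    have "s > 0"
      using nrm_nonneg[of x] by (simp add: s_def add_nonneg_pos add_pos_nonneg)
    define d where "d = min 1 (e / s)"
    have "d > 0"
      using \<open>e > 0\<close> \<open>s > 0\<close> by (simp add: d_def)
    let ?U = "ball c d \<times> mball x d"
    have "openin (prod_topology euclidean mtopology) ?U" "p \<in> ?U"
      using \<open>d > 0\<close> by (auto simp: p openin_prod_Times_iff)
    moreover have "(case q of (c, x) \<Rightarrow> smul c x) \<in> mball (case p of (c, x) \<Rightarrow> smul c x) e"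
      if "q \<in> ?U" for q
    proof -
      obtain c' x' where q: "q = (c', x')" by fastforce
      have c': "norm (c' - c) < d" and x': "nrm (x' - x) < d"
        using that by (auto simp: q dist_norm norm_minus_commute)
      have "nrm x' \<le> nrm x + 1"
        using nrm_triangle[of x "x' - x"] x' by (simp add: d_def)
      then have "norm (c' - c) * nrm x' < d * (nrm x + 1)"
        using c' nrm_nonneg[of x] nrm_nonneg[of x']
        by (smt (verit) mult_left_mono mult_strict_right_mono norm_ge_zero)
      moreover have "norm c * nrm (x' - x) \<le> norm c * d"
        using x' by (simp add: mult_left_mono)
      moreover have "nrm (smul c' x' - smul c x) \<le> norm (c' - c) * nrm x' + norm c * nrm (x' - x)"
        using nrm_triangle[of "smul (c' - c) x'" "smul c (x' - x)"]
        unfolding nrm_smul by (simp add: scale_left_diff_distrib scale_right_diff_distrib)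
      ultimately have "nrm (smul c' x' - smul c x) < d * s"
        by (simp add: s_def algebra_simps)
      also have "d * s \<le> e"
        using \<open>s > 0\<close> by (simp add: d_def min_def field_simps)
      finally show ?thesis
        by (simp add: p q)
    qed
    ultimately show "\<exists>U. openin (prod_topology euclidean mtopology) U \<and> p \<in> U \<and>
      (\<forall>q\<in>U. (case q of (c, x) \<Rightarrow> smul c x) \<in> mball (case p of (c, x) \<Rightarrow> smul c x) e)"
      by blast
  qed
qed

end

section \<open>Norm perturbations of a generating family and the theorem over both fields\<close>

text \<open>The topological result applies to the metric topology of the norm; since
  \<open>I\<close> is finite, the radii of balls inside the neighbourhoods have a common positive
  lower bound.\<close>

lemma Alg_eq_UNIV_norm_stable:
  fixes smul :: "'f::{real_normed_field, heine_borel} \<Rightarrow> 'a::ab_group_add \<Rightarrow> 'a"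
  assumes alg: "fin_dim_algebra smul mul" and norm: "vector_space_norm smul nrm"
    and fin: "finite I" and gen: "Alg smul mul (A ` I) = UNIV"
  shows "\<exists>\<epsilon>>0. \<forall>X. Max ((\<lambda>i. nrm (X i - A i)) ` I) < \<epsilon> \<longrightarrow> Alg smul mul (X ` I) = UNIV"
proof -
  interpret fin_dim_algebra smul mul by fact
  interpret N: normed_vector_space smul nrm
    by unfold_locales (fact norm)
  interpret topological_fin_dim_algebra smul mul N.mtopology
    by unfold_locales (rule N.vector_space_topology_mtopology)
  obtain U where U: "\<And>i. i \<in> I \<Longrightarrow> openin N.mtopology (U i) \<and> A i \<in> U i"
    "\<And>X. \<forall>i\<in>I. X i \<in> U i \<Longrightarrow> Alg smul mul (X ` I) = UNIV"
    using Alg_neighbourhoods[of I A] gen by metis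
  then have "\<forall>i\<in>I. \<exists>r>0. N.mball (A i) r \<subseteq> U i"
    unfolding N.openin_mtopology by blast
  then obtain r where r: "\<And>i. i \<in> I \<Longrightarrow> r i > 0 \<and> N.mball (A i) (r i) \<subseteq> U i"
    by metis
  \<comment> \<open>The element 1 keeps the minimum over a nonempty set when \<open>I\<close> is
    empty. \<open>Max\<close> is then unspecified, but the condition \<open>X i \<in> U i\<close> is
    vacuous.\<close>
  define \<epsilon> where "\<epsilon> = Min (insert 1 (r ` I))"
  have "\<epsilon> > 0"
    using fin r by (auto simp: \<epsilon>_def)
  moreover have "Alg smul mul (X ` I) = UNIV"
    if less: "Max ((\<lambda>i. nrm (X i - A i)) ` I) < \<epsilon>" for X
  proof (rule U(2), rule ballI)
    fix i assume i: "i \<in> I"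
    have "nrm (X i - A i) \<le> Max ((\<lambda>i. nrm (X i - A i)) ` I)"
      using fin i by simp
    also note less
    also have "\<epsilon> \<le> r i"
      using fin i by (simp add: \<epsilon>_def)
    finally have "X i \<in> N.mball (A i) (r i)"
      by simp
    then show "X i \<in> U i"
      using r[OF i] by blast
  qed
  ultimately show ?thesis
    by blast
qed

theorem theorem5p3:
  fixes smul_real :: "real \<Rightarrow> 'a::ab_group_add \<Rightarrow> 'a"
    and smul_complex :: "complex \<Rightarrow> 'a \<Rightarrow> 'a"
    and mul :: "'a \<Rightarrow> 'a \<Rightarrow> 'a"
    and T :: "'a topology"
    and nrm :: "'a \<Rightarrow> real"
    and k :: nat
    and A :: "nat \<Rightarrow> 'a"
  shows
    "(fin_dim_algebra smul_real mul \<and> vector_space_topology smul_real T \<longrightarrow>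
      (\<exists>U :: nat \<Rightarrow> 'a set.
         (\<forall>i\<in>{1..k}. openin T (U i) \<and> A i \<in> U i) \<and>
         (\<forall>X. (\<forall>i\<in>{1..k}. X i \<in> U i) \<longrightarrow>
            vector_space.dim smul_real (Alg smul_real mul (X ` {1..k}))
              \<ge> vector_space.dim smul_real (Alg smul_real mul (A ` {1..k}))) \<and>
         (Alg smul_real mul (A ` {1..k}) = UNIV \<longrightarrow>
            (\<forall>X. (\<forall>i\<in>{1..k}. X i \<in> U i) \<longrightarrow> Alg smul_real mul (X ` {1..k}) = UNIV)))) \<and>
     (fin_dim_algebra smul_complex mul \<and> vector_space_topology smul_complex T \<longrightarrow>
      (\<exists>U :: nat \<Rightarrow> 'a set.
         (\<forall>i\<in>{1..k}. openin T (U i) \<and> A i \<in> U i) \<and>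
         (\<forall>X. (\<forall>i\<in>{1..k}. X i \<in> U i) \<longrightarrow>
            vector_space.dim smul_complex (Alg smul_complex mul (X ` {1..k}))
              \<ge> vector_space.dim smul_complex (Alg smul_complex mul (A ` {1..k}))) \<and>
         (Alg smul_complex mul (A ` {1..k}) = UNIV \<longrightarrow>
            (\<forall>X. (\<forall>i\<in>{1..k}. X i \<in> U i) \<longrightarrow> Alg smul_complex mul (X ` {1..k}) = UNIV)))) \<and>
     (fin_dim_algebra smul_real mul \<and> vector_space_norm smul_real nrm \<and>
      Alg smul_real mul (A ` {1..k}) = UNIV \<longrightarrow>
      (\<exists>\<epsilon>>0. \<forall>X. Max ((\<lambda>i. nrm (X i - A i)) ` {1..k}) < \<epsilon> \<longrightarrow>
         Alg smul_real mul (X ` {1..k}) = UNIV)) \<and>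
     (fin_dim_algebra smul_complex mul \<and> vector_space_norm smul_complex nrm \<and>
      Alg smul_complex mul (A ` {1..k}) = UNIV \<longrightarrow>
      (\<exists>\<epsilon>>0. \<forall>X. Max ((\<lambda>i. nrm (X i - A i)) ` {1..k}) < \<epsilon> \<longrightarrow>
         Alg smul_complex mul (X ` {1..k}) = UNIV))"
proof (intro conjI impI; elim conjE)
  \<comment> \<open>Both fields are \<open>heine_borel\<close> normed fields, so the general results
    apply to each with \<open>I = {1..k}\<close>.\<close>
  assume "fin_dim_algebra smul_real mul" "vector_space_topology smul_real T"
  then interpret topological_fin_dim_algebra smul_real mul T
    by (simp add: topological_fin_dim_algebra_def topological_fin_dim_algebra_axioms_def)
  show "\<exists>U :: nat \<Rightarrow> 'a set.
         (\<forall>i\<in>{1..k}. openin T (U i) \<and> A i \<in> U i) \<and>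
         (\<forall>X. (\<forall>i\<in>{1..k}. X i \<in> U i) \<longrightarrow>
            dim (Alg smul_real mul (X ` {1..k})) \<ge> dim (Alg smul_real mul (A ` {1..k}))) \<and>
         (Alg smul_real mul (A ` {1..k}) = UNIV \<longrightarrow>
            (\<forall>X. (\<forall>i\<in>{1..k}. X i \<in> U i) \<longrightarrow> Alg smul_real mul (X ` {1..k}) = UNIV))"
    by (rule Alg_neighbourhoods)
next
  assume "fin_dim_algebra smul_complex mul" "vector_space_topology smul_complex T"
  then interpret topological_fin_dim_algebra smul_complex mul T
    by (simp add: topological_fin_dim_algebra_def topological_fin_dim_algebra_axioms_def)
  show "\<exists>U :: nat \<Rightarrow> 'a set.
         (\<forall>i\<in>{1..k}. openin T (U i) \<and> A i \<in> U i) \<and>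
         (\<forall>X. (\<forall>i\<in>{1..k}. X i \<in> U i) \<longrightarrow>
            dim (Alg smul_complex mul (X ` {1..k})) \<ge> dim (Alg smul_complex mul (A ` {1..k}))) \<and>
         (Alg smul_complex mul (A ` {1..k}) = UNIV \<longrightarrow>
            (\<forall>X. (\<forall>i\<in>{1..k}. X i \<in> U i) \<longrightarrow> Alg smul_complex mul (X ` {1..k}) = UNIV))"
    by (rule Alg_neighbourhoods)
qed (rule Alg_eq_UNIV_norm_stable; simp)+

end
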